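(* Let $p$ be a prime and suppose $E\subset\mathbb{F}_p^3$ $1$-tiles $\mathbb{F}_p^3$ by $A\subset\mathbb{F}_p^3$. Then the tiling $(E,A)$ is graphical, i.e., either $E$ or $A$ is a graph. More generally, if $d\ge1$ and $(E,A)$ is a tiling pair in $\mathbb{F}_p^d$ (i.e., $E$ $1$-tiles $\mathbb{F}_p^d$ by $A$) with $|E|=p$ or $|E|=p^{d-1}$, then either $E$ or $A$ is a graph.
   Context: $E$ $1$-tiles $\mathbb{F}_p^d$ by $A$ means $\sum_{a\in A}1_E(x-a)=1$ for every $x\in\mathbb{F}_p^d$. A set $E\subset\mathbb{F}_p^d$ is a graph if there exist an integer $0\le s\le d$, a basis $e_1,\dots,e_d$ of $\mathbb{F}_p^d$ and a function $f=(f_1,\dots,f_{d-s}):\mathbb{F}_p^s\to\mathbb{F}_p^{d-s}$ such that $E=\{\sum_{i=1}^s x_ie_i+\sum_{j=1}^{d-s}f_j(x)e_{s+j}: x\in\mathbb{F}_p^s\}$. *)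

theory Defs
  imports "Berlekamp_Zassenhaus.Finite_Field" "HOL-Analysis.Cartesian_Space" "HOL-Library.FuncSet" "HOL-Library.Indicator_Function"
begin

text \<open>
  The field with p elements is \<open>'p mod_ring\<close> for a type \<open>'p\<close> of class \<open>prime_card\<close>,
  with p = \<open>CARD('p)\<close>; the space of dimension d = \<open>CARD('d)\<close> over it is \<open>'p mod_ring ^ 'd\<close>.
\<close>

definition one_tiles :: "('p::prime_card mod_ring ^ 'd::finite) set \<Rightarrow> ('p mod_ring ^ 'd) set \<Rightarrow> bool" where
  "one_tiles E A \<longleftrightarrow> (\<forall>x. (\<Sum>a\<in>A. indicator E (x - a)) = (1::nat))"

text \<open>
  The exponent n varies inside the definition of a graph, so n-tuples are
  extensional functions on \<open>{..<n}\<close>; all indices start at 0.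
\<close>

definition tuples :: "nat \<Rightarrow> (nat \<Rightarrow> 'p::prime_card mod_ring) set" where
  "tuples n = {..<n} \<rightarrow>\<^sub>E UNIV"

definition is_ordered_basis :: "(nat \<Rightarrow> 'p::prime_card mod_ring ^ 'd::finite) \<Rightarrow> bool" where
  "is_ordered_basis e \<longleftrightarrow>
     inj_on e {..<CARD('d)} \<and>
     vec.independent (e ` {..<CARD('d)}) \<and>
     vec.span (e ` {..<CARD('d)}) = UNIV"

definition is_graph :: "('p::prime_card mod_ring ^ 'd::finite) set \<Rightarrow> bool" where
  "is_graph E \<longleftrightarrow>
     (\<exists>s e f. s \<le> CARD('d) \<and> is_ordered_basis e \<and>
        f \<in> tuples s \<rightarrow> tuples (CARD('d) - s) \<and>
        E = {(\<Sum>i<s. x i *s e i) + (\<Sum>j<CARD('d) - s. f x j *s e (s + j)) | x. x \<in> tuples s})"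

end

theory Submission
  imports Defs "HOL-Computational_Algebra.Polynomial_Factorial"
begin

text \<open>
  If \<open>E\<close> tiles by \<open>A\<close>, the set of size \<open>p\<close> is always a graph over a line; say it is \<open>E\<close>.
  Pushing \<open>E\<close> and \<open>A\<close> forward along a functional \<open>x \<mapsto> u \<cdot> x\<close> with \<open>u \<noteq> 0\<close> gives
  two integer polynomials of degree less than \<open>p\<close> whose product is a multiple of
  \<open>\<Phi> = 1 + X + \<dots> + X^(p-1)\<close>. As \<open>\<Phi>\<close> is irreducible (modulo \<open>p\<close> it is \<open>(X - 1)^(p-1)\<close>,
  whereas \<open>\<Phi>(1) = p\<close> is not divisible by \<open>p\<^sup>2\<close>), it divides one of them, and so
  \<open>E\<close> or \<open>A\<close> is equidistributed over the fibres of the functional. A double count over the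
  hyperplanes through a point outside \<open>A\<close> shows that \<open>A\<close> cannot be equidistributed for all
  \<open>u\<close>. Hence for some \<open>u\<close> each fibre contains exactly one point of \<open>E\<close>. In dimension 3
  the only other sizes are 1 and \<open>p\<^sup>3\<close>, which are trivial.
\<close>

section \<open>The polynomial \<open>1 + X + ... + X^(n-1)\<close> and its irreducibility over the
  integers for prime \<open>n\<close>\<close>

definition geom_poly :: "nat \<Rightarrow> 'a::comm_ring_1 poly" where
  "geom_poly n = (\<Sum>i<n. Polynomial.monom 1 i)"

lemma coeff_geom_poly: "Polynomial.coeff (geom_poly n) i = (if i < n then 1 else 0)"
  by (auto simp: geom_poly_def coeff_sum)

lemma degree_geom_poly: "n > 0 \<Longrightarrow> degree (geom_poly n :: 'a::comm_ring_1 poly) = n - 1"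
  by (intro antisym degree_le le_degree) (auto simp: coeff_geom_poly)

lemma monom_minus_1_eq_geom_poly:
  "Polynomial.monom 1 n - 1 = [:-1, 1:] * (geom_poly n :: 'a::comm_ring_1 poly)"
  using power_diff_1_eq[of "[:0, 1:] :: 'a poly" n]
  by (simp add: geom_poly_def monom_altdef one_pCons)

text \<open>In characteristic \<open>p\<close> the Frobenius map gives
  \<open>X^p - 1 = (X - 1)^p\<close>; one factor \<open>X - 1\<close> cancels.\<close>

lemma geom_poly_mod_ring:
  "(geom_poly CARD('p) :: 'p::prime_card mod_ring poly) = [:-1, 1:] ^ (CARD('p) - 1)"
proof -
  have p: "prime CHAR('p mod_ring poly)" "CHAR('p mod_ring poly) = CARD('p)"
    using prime_card[where 'a='p] by simp_all
  have "(Polynomial.monom 1 CARD('p) - 1 :: 'p mod_ring poly) + 1 = ([:-1, 1:] + 1) ^ CARD('p)"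
    by (simp add: monom_altdef one_pCons)
  also have "\<dots> = [:-1, 1:] ^ CARD('p) + 1"
    using freshmans_dream[OF p(1) p(2)[symmetric], of "[:-1, 1:]" 1] by simp
  finally have "[:-1, 1:] * geom_poly CARD('p) = ([:-1, 1:] ^ CARD('p) :: 'p mod_ring poly)"
    by (simp add: monom_minus_1_eq_geom_poly)
  also have "\<dots> = [:-1, 1:] * [:-1, 1:] ^ (CARD('p) - 1)"
    by (metis zero_less_card_finite power_eq_if less_irrefl)
  finally show ?thesis by (subst (asm) mult_left_cancel) auto
qed

text \<open>Up to units, \<open>X - 1\<close> is the only prime factor of
  \<open>(X - 1)^(p-1)\<close>; a divisor not vanishing at 1 is coprime to that power and hence a
  unit.\<close>

lemma poly_1_eq_0_if_dvd_geom_poly: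
  fixes g :: "'p::prime_card mod_ring poly"
  assumes "g dvd geom_poly CARD('p)" and "degree g > 0"
  shows "poly g 1 = 0"
proof (rule ccontr)
  assume "poly g 1 \<noteq> 0"
  then have "\<not> [:-1, 1:] dvd g" by (simp add: poly_eq_0_iff_dvd)
  then have "coprime [:-1, 1:] g"
    by (intro prime_elem_imp_coprime prime_elem_linear_field_poly) auto
  then have "coprime g ([:-1, 1:] ^ (CARD('p) - 1))"
    by (simp add: coprime_commute)
  with assms(1) have "is_unit g"
    unfolding geom_poly_mod_ring by (meson coprime_absorb_left)
  with assms(2) show False by (simp add: is_unit_iff_degree poly_dvd_1)
qed

lemma irreducible_geom_poly: "irreducible (geom_poly CARD('p::prime_card) :: int poly)"
proof -
  define \<Phi> where "\<Phi> = (geom_poly CARD('p) :: int poly)"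
  define r where "r = (map_poly of_int :: int poly \<Rightarrow> 'p mod_ring poly)"
  have p: "prime CARD('p)" by (rule prime_card)
  have deg: "degree \<Phi> = CARD('p) - 1" by (simp add: \<Phi>_def degree_geom_poly)
  have lead: "lead_coeff \<Phi> = 1" unfolding deg by (simp add: \<Phi>_def coeff_geom_poly)
  have val: "poly \<Phi> 1 = int CARD('p)" by (simp add: \<Phi>_def geom_poly_def poly_sum poly_monom)
  have r\<Phi>: "r \<Phi> = geom_poly CARD('p)"
    by (intro poly_eqI) (simp add: r_def \<Phi>_def coeff_map_poly coeff_geom_poly)
  have dvd: "int CARD('p) dvd poly G 1" if GH: "\<Phi> = G * H" and G: "\<not> is_unit G" for G H
  proof -
    have "lead_coeff G * lead_coeff H = 1" using lead by (simp add: GH lead_coeff_mult)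
    then have lG: "lead_coeff G = 1 \<or> lead_coeff G = -1" by (auto simp: zmult_eq_1_iff)
    have "degree G \<noteq> 0"
    proof
      assume "degree G = 0"
      then obtain c where "G = [:c:]" by (rule degree_eq_zeroE)
      with lG G show False by (auto simp: is_unit_const_poly_iff)
    qed
    \<comment> \<open>The leading coefficient is 1 or -1, so it survives reduction modulo
      \<open>p\<close>.\<close>
    moreover have "degree G \<le> degree (r G)"
      using lG by (intro le_degree) (auto simp: r_def coeff_map_poly)
    ultimately have "degree (r G) > 0" by simp
    moreover have "r \<Phi> = r G * r H" unfolding GH r_def by (rule of_int_poly_hom.hom_mult)
    ultimately have "poly (r G) 1 = 0"
      using r\<Phi> by (intro poly_1_eq_0_if_dvd_geom_poly) auto
    then have "of_int (poly G 1) = (0 :: 'p mod_ring)"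
      using of_int_hom.poly_map_poly[of G 1, where 'a = "'p mod_ring"] by (simp add: r_def)
    then show ?thesis by (simp add: of_int_eq_0_iff_char_dvd)
  qed
  have "irreducible \<Phi>"
  proof (rule irreducibleI)
    show "\<Phi> \<noteq> 0" using lead by auto
    show "\<not> is_unit \<Phi>"
      using deg prime_gt_1_nat[OF p] by (auto simp: poly_dvd_1)
  next
    fix G H assume GH: "\<Phi> = G * H"
    show "is_unit G \<or> is_unit H"
    proof (rule ccontr)
      assume "\<not> (is_unit G \<or> is_unit H)"
      \<comment> \<open>Two non-unit factors would both be divisible by \<open>p\<close> at 1,
        although the product of their values is only \<open>p\<close>.\<close>
      with dvd[OF GH] dvd[of H G] GH
      have "int CARD('p) * int CARD('p) dvd poly G 1 * poly H 1"
        by (intro mult_dvd_mono) (auto simp: mult.commute)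
      also have "\<dots> = int CARD('p) * 1" using val by (simp add: GH)
      finally have "int CARD('p) dvd 1" by (subst (asm) dvd_mult_cancel_left) auto
      with prime_gt_1_nat[OF p] show False by auto
    qed
  qed
  then show ?thesis by (simp add: \<Phi>_def)
qed

text \<open>The degree bound leaves room only for a constant cofactor.\<close>

lemma geom_poly_dvd_imp_coeffs_eq:
  fixes f :: "int poly"
  assumes "geom_poly n dvd f" "degree f < n"
  obtains c where "\<And>i. i < n \<Longrightarrow> Polynomial.coeff f i = c"
proof -
  from assms(1) obtain g where g: "f = geom_poly n * g" ..
  have n: "n > 0" using assms(2) by simp
  have "degree g = 0"
  proof (cases "g = 0")
    case False
    moreover have "geom_poly n \<noteq> (0 :: int poly)"
      using n coeff_geom_poly[of n 0, where 'a=int] by auto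
    ultimately show ?thesis
      using assms(2) n by (simp add: g degree_mult_eq degree_geom_poly)
  qed simp
  then obtain c where "g = [:c:]" by (rule degree_eq_zeroE)
  then have "Polynomial.coeff f i = c" if "i < n" for i
    using that by (simp add: g coeff_geom_poly)
  then show ?thesis by (rule that)
qed

section \<open>Linear functionals and their fibres\<close>

definition dot :: "'a::comm_ring_1 ^ 'd \<Rightarrow> 'a ^ 'd \<Rightarrow> 'a" where
  "dot u x = (\<Sum>i\<in>UNIV. u $ i * x $ i)"

lemma dot_commute: "dot u x = dot x u"
  by (simp add: dot_def mult.commute)

lemma dot_add_right: "dot u (x + y) = dot u x + dot u y"
  by (simp add: dot_def distrib_left sum.distrib)

lemma dot_diff_right: "dot u (x - y) = dot u x - dot u y"
  by (simp add: dot_def right_diff_distrib sum_subtractf)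

lemma dot_scale_right: "dot u (c *s x) = c * dot u x"
  by (simp add: dot_def sum_distrib_left mult.left_commute)

lemma dot_zero [simp]: "dot 0 x = 0" "dot u 0 = 0"
  by (simp_all add: dot_def)

lemma dot_surj:
  fixes u :: "'a::field ^ 'd"
  assumes "u \<noteq> 0"
  obtains x where "dot u x = t"
proof -
  from assms obtain k where k: "u $ k \<noteq> 0" by (auto simp: vec_eq_iff)
  have "dot u (axis k (t / u $ k)) = (\<Sum>i\<in>UNIV. if i = k then t else 0)"
    using k unfolding dot_def by (intro sum.cong) (auto simp: axis_def)
  then show ?thesis by (intro that[of "axis k (t / u $ k)"]) simp
qed

text \<open>Translations permute the fibres of the functional, so all have the same size. The
  product form avoids the exponent \<open>CARD('d) - 1\<close>.\<close>

lemma card_hyperplane: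
  fixes u :: "'a::{finite,field} ^ 'd::finite"
  assumes "u \<noteq> 0"
  shows "CARD('a) * card {x. dot u x = t} = CARD('a) ^ CARD('d)"
proof -
  have eq: "card {x. dot u x = s} = card {x. dot u x = t}" for s
  proof -
    obtain v where v: "dot u v = t - s" using dot_surj[OF assms] .
    have "bij_betw (\<lambda>x. x + v) {x. dot u x = s} {x. dot u x = t}"
      by (rule bij_betwI[where g = "\<lambda>x. x - v"])
         (auto simp: dot_add_right dot_diff_right v)
    then show ?thesis by (rule bij_betw_same_card)
  qed
  have "CARD('a ^ 'd) = (\<Sum>s\<in>UNIV. card {x. dot u x = s})"
    using sum.group[of UNIV UNIV "dot u" "\<lambda>_. 1::nat"] by simp
  also have "\<dots> = CARD('a) * card {x. dot u x = t}"
    by (subst eq) simp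
  finally show ?thesis by (simp add: CARD_vec)
qed

text \<open>Fix \<open>z\<close> outside \<open>A\<close> and sum
  \<open>q * card {a\<in>A. dot u a = dot u z}\<close> over all \<open>u\<close>. Each
  \<open>a\<close> in \<open>A\<close> differs from \<open>z\<close>, so it is counted for a
  hyperplane of \<open>u\<close>, and the average over \<open>u\<close> is exactly
  \<open>card A\<close>. If every nonzero \<open>u\<close> gave \<open>card A\<close>, the value
  \<open>q * card A\<close> at \<open>u = 0\<close> would push the average above this.\<close>

lemma ex_nonuniform_functional:
  fixes A :: "('a::{finite,field} ^ 'd::finite) set"
  assumes "A \<noteq> {}" "A \<noteq> UNIV"
  obtains u t where "u \<noteq> 0" "CARD('a) * card {a\<in>A. dot u a = t} \<noteq> card A"
proof (rule ccontr)
  assume "\<not> thesis"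
  with that have unif: "CARD('a) * card {a\<in>A. dot u a = t} = card A" if "u \<noteq> 0" for u t
    using that by blast
  obtain z where z: "z \<notin> A" using assms(2) by auto
  define q where "q = CARD('a)"
  have "card {0, 1 :: 'a} \<le> q" unfolding q_def by (rule card_mono) auto
  then have q: "q > 1" by simp
  have [simp]: "finite A" by simp
  have "(\<Sum>u\<in>UNIV. q * card {a\<in>A. dot u a = dot u z})
      = (\<Sum>u\<in>UNIV. \<Sum>a\<in>A. q * (if dot u a = dot u z then 1 else 0))"
    by (simp add: sum.If_cases Int_def flip: sum_distrib_left)
  also have "\<dots> = (\<Sum>a\<in>A. \<Sum>u\<in>UNIV. q * (if dot u a = dot u z then 1 else 0))"
    by (rule sum.swap)
  also have "\<dots> = (\<Sum>a\<in>A. q * card {u. dot (a - z) u = 0})"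
    by (simp add: sum.If_cases Int_def dot_commute[of _ a for a] dot_diff_right
          flip: sum_distrib_left)
  also have "\<dots> = (\<Sum>a\<in>A. q ^ CARD('d))"
    unfolding q_def using z by (intro sum.cong refl card_hyperplane) auto
  also have "\<dots> = (\<Sum>u\<in>(UNIV :: ('a ^ 'd) set). card A)"
    by (simp add: q_def CARD_vec)
  also have "\<dots> < (\<Sum>u\<in>UNIV. q * card {a\<in>A. dot u a = dot u z})"
  proof (rule sum_strict_mono_ex1)
    show "\<forall>u\<in>UNIV. card A \<le> q * card {a\<in>A. dot u a = dot u z}"
    proof
      fix u
      show "card A \<le> q * card {a\<in>A. dot u a = dot u z}"
        using q unif[of u "dot u z"] by (cases "u = 0") (auto simp: q_def)
    qed
    show "\<exists>u\<in>UNIV. card A < q * card {a\<in>A. dot u a = dot u z}"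
      using q assms(1) by (intro bexI[of _ 0]) (auto simp: card_gt_0_iff)
  qed simp
  finally show False by simp
qed

section \<open>Ordered bases, coordinates and criteria for being a graph\<close>

lemma independent_spanning_imp_is_ordered_basis:
  fixes e :: "nat \<Rightarrow> 'p::prime_card mod_ring ^ 'd::finite"
  assumes B: "vec.independent B" "vec.span B = UNIV" and e: "bij_betw e {..<card B} B"
  shows "is_ordered_basis e"
proof -
  have "card B = CARD('d)"
    using vec.dim_span_eq_card_independent[OF B(1)] B(2)
    by (simp add: vec.dim_UNIV card_cart_basis)
  with e B show ?thesis by (auto simp: is_ordered_basis_def bij_betw_def)
qed

lemma ex_ordered_basis: "\<exists>e :: nat \<Rightarrow> 'p::prime_card mod_ring ^ 'd::finite. is_ordered_basis e"
proof -
  obtain B :: "('p mod_ring ^ 'd) set" where "vec.independent B" "vec.span B = UNIV"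
    using vec.basis_subspace_exists[OF vec.subspace_UNIV] by metis
  moreover obtain e where "bij_betw e {..<card B} B"
    using ex_bij_betw_nat_finite[of B] by (auto simp: atLeast0LessThan)
  ultimately show ?thesis using independent_spanning_imp_is_ordered_basis by blast
qed

lemma tuples_0: "tuples 0 = {\<lambda>_. undefined}"
  by (simp add: tuples_def)

lemma basis_coords:
  fixes e :: "nat \<Rightarrow> 'p::prime_card mod_ring ^ 'd::finite"
  assumes "inj_on e {..<n}" "v \<in> vec.span (e ` {..<n})"
  obtains x where "x \<in> tuples n" "v = (\<Sum>i<n. x i *s e i)"
proof -
  from assms(2) obtain c where "v = (\<Sum>w\<in>e ` {..<n}. c w *s w)"
    by (auto simp: vec.span_finite)
  then have "v = (\<Sum>i<n. restrict (c \<circ> e) {..<n} i *s e i)"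
    using assms(1) by (simp add: sum.reindex)
  then show ?thesis
    by (intro that[of "restrict (c \<circ> e) {..<n}"]) (auto simp: tuples_def)
qed

lemma is_graph_UNIV: "is_graph (UNIV :: ('p::prime_card mod_ring ^ 'd::finite) set)"
proof -
  obtain e :: "nat \<Rightarrow> 'p mod_ring ^ 'd" where e: "is_ordered_basis e"
    using ex_ordered_basis by blast
  have "\<exists>x. v = (\<Sum>i<CARD('d). x i *s e i) \<and> x \<in> tuples CARD('d)" for v
    using e basis_coords[of e "CARD('d)" v] by (auto simp: is_ordered_basis_def)
  with e show ?thesis
    unfolding is_graph_def
    \<comment> \<open>Here \<open>s\<close> is the full dimension; the constant
      \<open>undefined\<close> function is the only element of \<open>tuples 0\<close>.\<close>
    by (intro exI[of _ "CARD('d)"] exI[of _ e] exI[of _ "\<lambda>_ _. undefined"])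
       (auto simp: tuples_0)
qed

lemma is_graph_singleton: "is_graph {v :: 'p::prime_card mod_ring ^ 'd::finite}"
proof -
  obtain e :: "nat \<Rightarrow> 'p mod_ring ^ 'd" where e: "is_ordered_basis e"
    using ex_ordered_basis by blast
  then obtain x where "x \<in> tuples CARD('d)" "v = (\<Sum>i<CARD('d). x i *s e i)"
    using basis_coords[of e "CARD('d)" v] by (auto simp: is_ordered_basis_def)
  with e show ?thesis
    unfolding is_graph_def
    \<comment> \<open>With \<open>s = 0\<close> the domain is one point, and \<open>f\<close> sends
      it to the coordinates of \<open>v\<close>.\<close>
    by (intro exI[of _ 0] exI[of _ e] exI[of _ "\<lambda>_. x"]) (auto simp: tuples_0)
qed

text \<open>Complete a vector \<open>w\<close> with \<open>dot u w = 1\<close> by a basis of the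
  kernel of \<open>dot u\<close>. The \<open>w\<close>-coordinate of a point is then its value under
  \<open>dot u\<close>, and on \<open>E\<close> this value determines the point, so \<open>E\<close>
  is a graph with \<open>s = 1\<close>.\<close>

lemma is_graph_if_bij_betw_dot:
  fixes E :: "('p::prime_card mod_ring ^ 'd::finite) set"
  assumes u: "u \<noteq> 0" and E: "bij_betw (dot u) E UNIV"
  shows "is_graph E"
proof -
  obtain w where w: "dot u w = 1" using dot_surj[OF u] .
  define K where "K = {x. dot u x = 0}"
  have "vec.subspace K"
    by (auto simp: K_def vec.subspace_def dot_add_right dot_scale_right)
  then obtain B where B: "finite B" "B \<subseteq> K" "vec.independent B" "vec.span B = K"
    by (rule vec.basis_subspace_exists)
  have wB: "w \<notin> vec.span B" using w by (simp add: B K_def)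
  then have wB': "w \<notin> B" using vec.span_base by blast
  define n where "n = card B"
  obtain b where b: "bij_betw b {..<n} B"
    using ex_bij_betw_nat_finite[OF B(1)] by (auto simp: atLeast0LessThan n_def)
  \<comment> \<open>Index 0 is reserved for \<open>w\<close>, the direction of the domain; the
    kernel basis is shifted by one.\<close>
  define e where "e = (\<lambda>i. case i of 0 \<Rightarrow> w | Suc j \<Rightarrow> b j)"
  have indep: "vec.independent (insert w B)" using wB B(3) by (rule vec.independent_insertI)
  have "x \<in> vec.span (insert w B)" for x
  proof -
    have "x - dot u x *s w \<in> vec.span B"
      by (simp add: B K_def dot_diff_right dot_scale_right w)
    then show ?thesis by (auto simp: vec.span_insert)
  qed
  then have span: "vec.span (insert w B) = UNIV" by auto
  have card: "card (insert w B) = Suc n" using wB' B(1) by (simp add: n_def)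
  have "bij_betw e {..<Suc n} (insert w B)"
    unfolding bij_betw_def
  proof
    show "inj_on e {..<Suc n}"
      using b wB' by (auto simp: inj_on_def e_def bij_betw_def split: nat.splits)
    show "e ` {..<Suc n} = insert w B"
      using b by (auto simp: lessThan_Suc_eq_insert_0 image_image e_def bij_betw_def)
  qed
  then have e: "is_ordered_basis e"
    using independent_spanning_imp_is_ordered_basis[OF indep span] card by simp
  have d: "CARD('d) = Suc n"
    using vec.dim_span_eq_card_independent[OF indep] span card
    by (simp add: vec.dim_UNIV card_cart_basis)
  \<comment> \<open>The point of \<open>E\<close> on the fibre over \<open>t\<close>; its component
    in the kernel supplies the graph function.\<close>
  define g where "g = the_inv_into E (dot u)"
  have gE: "g t \<in> E" and dg: "dot u (g t) = t" for t
    using E the_inv_into_into[of "dot u" E t] f_the_inv_into_f[of "dot u" E t]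
    by (auto simp: g_def bij_betw_def)
  have gd: "g (dot u x) = x" if "x \<in> E" for x
    using E that by (simp add: g_def bij_betw_def the_inv_into_f_f)
  have "\<exists>c. c \<in> tuples n \<and> g t - t *s w = (\<Sum>j<n. c j *s b j)" for t
  proof -
    have "g t - t *s w \<in> vec.span (b ` {..<n})"
      using b by (simp add: bij_betw_def B K_def dot_diff_right dot_scale_right w dg)
    then show ?thesis using basis_coords[of b n] b by (metis bij_betw_def)
  qed
  then obtain c where c: "\<And>t. c t \<in> tuples n" "\<And>t. g t - t *s w = (\<Sum>j<n. c t j *s b j)"
    by metis
  have g: "g t = t *s w + (\<Sum>j<n. c t j *s b j)" for t
    using c(2)[of t] by (simp add: algebra_simps)
  have "E = {(\<Sum>i<1. x i *s e i) + (\<Sum>j<n. c (x 0) j *s e (1 + j)) | x. x \<in> tuples 1}"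
    (is "_ = ?R")
  proof (intro subset_antisym subsetI)
    fix v assume "v \<in> E"
    then have "v = g (dot u v)" by (simp add: gd)
    then show "v \<in> ?R"
      by (intro CollectI exI[of _ "\<lambda>i\<in>{..<1}. dot u v"])
         (auto simp: g e_def tuples_def)
  next
    fix v assume "v \<in> ?R"
    then obtain x where "v = g (x 0)" by (auto simp: g e_def)
    then show "v \<in> E" by (simp add: gE)
  qed
  with e c(1) show ?thesis
    unfolding is_graph_def d
    by (intro exI[of _ 1] exI[of _ e] exI[of _ "\<lambda>x. c (x 0)"]) auto
qed

section \<open>Pushforward polynomials and equidistribution over fibres\<close>

text \<open>This is the generating function of the fibre sizes of \<open>dot u\<close> on
  \<open>S\<close>, with residues represented by the exponents from 0 to \<open>p - 1\<close>.
  Modulo \<open>X^p - 1\<close> it is an element of the integral group ring of the cyclic group of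
  order \<open>p\<close>, where products are convolutions.\<close>

definition pushforward_poly :: "'p::prime_card mod_ring ^ 'd::finite \<Rightarrow> ('p mod_ring ^ 'd) set \<Rightarrow> int poly" where
  "pushforward_poly u S = (\<Sum>x\<in>S. Polynomial.monom 1 (nat (to_int_mod_ring (dot u x))))"

lemma to_int_mod_ring_bounds:
  "0 \<le> to_int_mod_ring (t :: 'p::prime_card mod_ring)"
  "to_int_mod_ring (t :: 'p::prime_card mod_ring) < int CARD('p)"
  using range_to_int_mod_ring[where 'a='p] by auto

lemma coeff_pushforward_poly:
  "Polynomial.coeff (pushforward_poly u S) (nat (to_int_mod_ring t)) = int (card {x\<in>S. dot u x = t})"
proof -
  have "nat (to_int_mod_ring s) = nat (to_int_mod_ring t) \<longleftrightarrow> s = t" for s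
    using arg_cong[of "to_int_mod_ring s" "to_int_mod_ring t" of_int_mod_ring]
    by (auto simp: eq_nat_nat_iff to_int_mod_ring_bounds(1))
  then show ?thesis
    by (simp add: pushforward_poly_def coeff_sum sum.If_cases Int_def)
qed

lemma degree_pushforward_poly:
  fixes S :: "('p::prime_card mod_ring ^ 'd::finite) set"
  shows "degree (pushforward_poly u S) < CARD('p)"
proof -
  have "degree (pushforward_poly u S) \<le> CARD('p) - 1"
    unfolding pushforward_poly_def
  proof (rule degree_sum_le)
    fix x assume "x \<in> S"
    have "nat (to_int_mod_ring (dot u x)) < CARD('p)"
      using to_int_mod_ring_bounds[of "dot u x"] by simp
    then show "degree (Polynomial.monom (1::int) (nat (to_int_mod_ring (dot u x)))) \<le> CARD('p) - 1"
      by (simp add: degree_monom_eq)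
  qed simp
  then show ?thesis using zero_less_card_finite[where 'a='p] by linarith
qed

text \<open>Divisibility together with degree less than \<open>p\<close> forces all coefficients,
  which are the fibre sizes, to agree.\<close>

lemma uniform_if_geom_poly_dvd:
  fixes S :: "('p::prime_card mod_ring ^ 'd::finite) set"
  assumes "geom_poly CARD('p) dvd pushforward_poly u S"
  shows "CARD('p) * card {x\<in>S. dot u x = t} = card S"
proof -
  obtain c where c: "\<And>i. i < CARD('p) \<Longrightarrow> Polynomial.coeff (pushforward_poly u S) i = c"
    by (rule geom_poly_dvd_imp_coeffs_eq[OF assms degree_pushforward_poly]) blast
  have eq: "int (card {x\<in>S. dot u x = s}) = c" for s
    using to_int_mod_ring_bounds[of s] by (subst coeff_pushforward_poly[symmetric], intro c) simp
  have "card S = (\<Sum>s\<in>UNIV. card {x\<in>S. dot u x = s})"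
    using sum.group[of S UNIV "dot u" "\<lambda>_. 1::nat"] by simp
  also have "\<dots> = (\<Sum>s\<in>(UNIV :: 'p mod_ring set). card {x\<in>S. dot u x = t})"
  proof (rule sum.cong)
    fix s show "card {x\<in>S. dot u x = s} = card {x\<in>S. dot u x = t}"
      using eq[of s] eq[of t] by linarith
  qed simp
  finally show ?thesis by simp
qed

text \<open>Since \<open>geom_poly n\<close> divides \<open>X^n - 1\<close>, exponents matter only
  modulo \<open>n\<close>.\<close>

lemma geom_poly_dvd_monom_diff:
  assumes "i mod n = j mod n"
  shows "geom_poly n dvd Polynomial.monom 1 i - (Polynomial.monom 1 j :: 'a::comm_ring_1 poly)"
proof -
  have "geom_poly n dvd Polynomial.monom 1 i - (Polynomial.monom 1 (i mod n) :: 'a poly)" for i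
  proof -
    have "Polynomial.monom 1 i = (Polynomial.monom 1 n ^ (i div n) * Polynomial.monom 1 (i mod n) :: 'a poly)"
      by (simp add: Polynomial.monom_power mult_monom)
    then have "Polynomial.monom 1 i - (Polynomial.monom 1 (i mod n) :: 'a poly)
        = (Polynomial.monom 1 n ^ (i div n) - 1) * Polynomial.monom 1 (i mod n)"
      by (simp add: algebra_simps)
    also have "geom_poly n dvd \<dots>"
      unfolding power_diff_1_eq monom_minus_1_eq_geom_poly by (intro dvd_mult2 dvd_mult dvd_refl)
    finally show ?thesis .
  qed
  from dvd_diff[OF this[of i] this[of j]] assms show ?thesis by simp
qed

section \<open>Tilings as unique decompositions, and their pushforwards\<close>

lemma one_tiles_bij_betw:
  assumes "one_tiles E A"
  shows "bij_betw (\<lambda>(e, a). e + a) (E \<times> A) UNIV"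
proof -
  have "card {a\<in>A. x - a \<in> E} = 1" for x
    using assms by (simp add: one_tiles_def indicator_def sum.If_cases Int_def)
  then have ex1: "\<exists>!a. a \<in> A \<and> x - a \<in> E" for x
    by (simp add: Ex1_def card_1_singleton_iff set_eq_iff) metis
  show ?thesis
    unfolding bij_betw_def
  proof
    show "inj_on (\<lambda>(e, a). e + a) (E \<times> A)"
    proof (rule inj_onI, clarify)
      fix e a e' a' assume *: "e \<in> E" "a \<in> A" "e' \<in> E" "a' \<in> A" "e + a = e' + a'"
      have "e + a - a \<in> E" using *(1) by simp
      moreover have "e + a - a' \<in> E" using *(3) by (simp add: *(5))
      ultimately have "a = a'" using ex1[of "e + a"] * by blast
      with * show "e = e' \<and> a = a'" by simp
    qed
    have "x \<in> (\<lambda>(e, a). e + a) ` (E \<times> A)" for x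
    proof -
      from ex1[of x] obtain a where "a \<in> A" "x - a \<in> E" by blast
      then show ?thesis by (intro image_eqI[of _ _ "(x - a, a)"]) auto
    qed
    then show "(\<lambda>(e, a). e + a) ` (E \<times> A) = UNIV" by auto
  qed
qed

lemma one_tiles_sym:
  assumes "one_tiles E A"
  shows "one_tiles A E"
  unfolding one_tiles_def
proof
  fix x
  note bij = one_tiles_bij_betw[OF assms]
  have "x \<in> (\<lambda>(e, a). e + a) ` (E \<times> A)"
    by (simp only: bij_betw_imp_surj_on[OF bij] UNIV_I)
  then obtain e a where ea: "e \<in> E" "a \<in> A" "x = e + a" by auto
  have "e' = e" if "e' \<in> E" "x - e' \<in> A" for e'
  proof -
    have "(e', x - e') = (e, a)"
      by (rule inj_onD[OF bij_betw_imp_inj_on[OF bij]]) (simp_all add: that ea(1,2) flip: ea(3))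
    then show ?thesis by simp
  qed
  moreover have "x - e \<in> A" using ea(2) by (simp add: ea(3))
  ultimately have "{e\<in>E. x - e \<in> A} = {e}" using ea(1) by blast
  then show "(\<Sum>e\<in>E. indicator A (x - e)) = (1::nat)"
    by (simp add: indicator_def sum.If_cases Int_def)
qed

lemma one_tiles_card:
  fixes E A :: "('p::prime_card mod_ring ^ 'd::finite) set"
  assumes "one_tiles E A"
  shows "card E * card A = CARD('p) ^ CARD('d)"
  using bij_betw_same_card[OF one_tiles_bij_betw[OF assms]]
  by (simp add: card_cartesian_product CARD_vec)

text \<open>
  In Fourier terms: \<open>geom_poly p\<close> divides the pushforward polynomial of a set at \<open>u\<close> iff the
  Fourier transform of its indicator function vanishes at \<open>u\<close>.
\<close>

lemma one_tiles_geom_poly_dvd: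
  fixes E A :: "('p::prime_card mod_ring ^ 'd::finite) set"
  assumes tiles: "one_tiles E A" and u: "u \<noteq> 0"
  shows "geom_poly CARD('p) dvd pushforward_poly u E * pushforward_poly u A"
proof -
  define n :: "'p mod_ring ^ 'd \<Rightarrow> nat" where "n x = nat (to_int_mod_ring (dot u x))" for x
  define N where "N = card {x. dot u x = 0}"
  \<comment> \<open>Representatives add only up to a multiple of \<open>p\<close>;
    \<open>geom_poly_dvd_monom_diff\<close> absorbs this wraparound.\<close>
  have n_add: "(n x + n y) mod CARD('p) = n (x + y) mod CARD('p)" for x y
  proof -
    have "int ((n x + n y) mod CARD('p)) = int (n (x + y) mod CARD('p))"
      by (simp add: n_def zmod_int to_int_mod_ring_bounds dot_add_right to_int_mod_ring_add)
    then show ?thesis by simp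
  qed
  \<comment> \<open>All fibres of \<open>dot u\<close> on the whole space have the same size
    \<open>N\<close>.\<close>
  have "pushforward_poly u UNIV = smult (int N) (geom_poly CARD('p))"
  proof (rule poly_eqI)
    fix i
    show "Polynomial.coeff (pushforward_poly u UNIV) i
        = Polynomial.coeff (smult (int N) (geom_poly CARD('p))) i"
    proof (cases "i < CARD('p)")
      case True
      then have i: "i = nat (to_int_mod_ring (of_int_mod_ring (int i) :: 'p mod_ring))" by simp
      have "CARD('p) * card {x. dot u x = of_int_mod_ring (int i)} = CARD('p) * N"
        using card_hyperplane[OF u, of "of_int_mod_ring (int i)"] card_hyperplane[OF u, of 0]
        by (simp add: N_def)
      then have "card {x. dot u x = of_int_mod_ring (int i)} = N" by simp
      then show ?thesis
        using True by (subst i, subst coeff_pushforward_poly) (simp add: coeff_geom_poly)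
    next
      case False
      then have "i > degree (pushforward_poly u (UNIV :: ('p mod_ring ^ 'd) set))"
        using degree_pushforward_poly[of u UNIV] by linarith
      with False show ?thesis by (simp add: coeff_eq_0 coeff_geom_poly)
    qed
  qed
  \<comment> \<open>Unique decomposition turns the sum over the space into a sum over pairs.\<close>
  moreover have "pushforward_poly u UNIV = (\<Sum>(e, a)\<in>E \<times> A. Polynomial.monom 1 (n (e + a)))"
    using sum.reindex_bij_betw[OF one_tiles_bij_betw[OF tiles],
        of "\<lambda>x. Polynomial.monom (1::int) (n x)", symmetric]
    by (simp add: pushforward_poly_def n_def case_prod_unfold)
  ultimately have "geom_poly CARD('p) dvd (\<Sum>(e, a)\<in>E \<times> A. Polynomial.monom (1::int) (n (e + a)))"
    using dvd_smult[OF dvd_refl, of "geom_poly CARD('p)" "int N"] by simp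
  moreover have "geom_poly CARD('p) dvd
      (\<Sum>(e, a)\<in>E \<times> A. Polynomial.monom (1::int) (n e + n a) - Polynomial.monom 1 (n (e + a)))"
    by (rule dvd_sum) (auto intro!: geom_poly_dvd_monom_diff n_add)
  moreover have "pushforward_poly u E * pushforward_poly u A
      = (\<Sum>(e, a)\<in>E \<times> A. Polynomial.monom 1 (n e + n a))"
    by (simp add: pushforward_poly_def n_def sum_product sum.cartesian_product mult_monom)
  ultimately show ?thesis
    by (simp add: case_prod_unfold sum_subtractf dvd_diff_left_iff)
qed

lemma one_tiles_card_prime_imp_is_graph:
  fixes E A :: "('p::prime_card mod_ring ^ 'd::finite) set"
  assumes tiles: "one_tiles E A" and E: "card E = CARD('p)"
  shows "is_graph E"
proof -
  have p: "CARD('p) > 1" using prime_gt_1_nat[OF prime_card[where 'a='p]] .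
  have "CARD('p) * card A = CARD('p) ^ CARD('d)" using one_tiles_card[OF tiles] E by simp
  then have "card A \<noteq> 0" "card A \<noteq> CARD('p) ^ CARD('d)" using p by auto
  then have "A \<noteq> {}" "A \<noteq> UNIV" by (auto simp: CARD_vec)
  then obtain u t where u: "u \<noteq> 0" and t: "CARD('p mod_ring) * card {a\<in>A. dot u a = t} \<noteq> card A"
    by (rule ex_nonuniform_functional)
  \<comment> \<open>The integer polynomials form a factorial ring, so irreducible elements are
    prime.\<close>
  have "prime_elem (geom_poly CARD('p) :: int poly)"
    using irreducible_geom_poly[where 'p='p] by (simp add: prime_elem_iff_irreducible)
  moreover have "\<not> geom_poly CARD('p) dvd pushforward_poly u A"
    using t uniform_if_geom_poly_dvd[of u A t] by auto
  ultimately have "geom_poly CARD('p) dvd pushforward_poly u E"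
    using one_tiles_geom_poly_dvd[OF tiles u] by (auto dest: prime_elem_dvd_multD)
  then have "CARD('p) * card {x\<in>E. dot u x = s} = CARD('p)" for s
    using uniform_if_geom_poly_dvd[of u E s] E by simp
  then have one: "card {x\<in>E. dot u x = s} = 1" for s by simp
  have "s \<in> dot u ` E" for s
  proof -
    have "{x\<in>E. dot u x = s} \<noteq> {}" using one[of s] by (metis card.empty zero_neq_one)
    then show ?thesis by blast
  qed
  then have "dot u ` E = UNIV" by blast
  \<comment> \<open>A surjection between sets of equal size \<open>p\<close> is injective.\<close>
  moreover from this have "inj_on (dot u) E"
    using E by (intro eq_card_imp_inj_on) simp_all
  ultimately show ?thesis using u by (intro is_graph_if_bij_betw_dot) (auto simp: bij_betw_def)
qed

theorem mainTheorem4: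
  shows "(\<forall>E A :: ('p::prime_card mod_ring ^ 3) set.
            one_tiles E A \<longrightarrow> is_graph E \<or> is_graph A) \<and>
         (\<forall>E A :: ('p mod_ring ^ 'd::finite) set.
            one_tiles E A \<and> (card E = CARD('p) \<or> card E = CARD('p) ^ (CARD('d) - 1)) \<longrightarrow>
            is_graph E \<or> is_graph A)"
proof (intro conjI allI impI)
  fix E A :: "('p mod_ring ^ 3) set"
  assume tiles: "one_tiles E A"
  note card = one_tiles_card[OF tiles]
  have p: "prime CARD('p)" by (rule prime_card)
  have "card E dvd card E * card A" by simp
  then have "card E dvd CARD('p) ^ 3" unfolding card by simp
  then obtain i where i: "i \<le> 3" "card E = CARD('p) ^ i"
    using divides_primepow_nat[OF p] by auto
  then consider "i = 0" | "i = 1" | "i = 2" | "i = 3" by linarith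
  then show "is_graph E \<or> is_graph A"
  proof cases
    case 1
    with i obtain v where "E = {v}" by (auto simp: card_1_singleton_iff)
    then show ?thesis by (simp add: is_graph_singleton)
  next
    case 2
    with i tiles show ?thesis by (simp add: one_tiles_card_prime_imp_is_graph)
  next
    case 3
    \<comment> \<open>The sizes multiply to \<open>p^3\<close>, so \<open>A\<close> takes over the
      role of the set of size \<open>p\<close>.\<close>
    with i card have "card A = CARD('p)" by (simp add: power2_eq_square power3_eq_cube)
    with tiles show ?thesis by (blast intro: one_tiles_card_prime_imp_is_graph one_tiles_sym)
  next
    case 4
    with i have "E = UNIV" by (intro card_eq_UNIV_imp_eq_UNIV) (simp_all add: CARD_vec)
    then show ?thesis by (simp add: is_graph_UNIV)
  qed
next
  fix E A :: "('p mod_ring ^ 'd) set"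
  assume *: "one_tiles E A \<and> (card E = CARD('p) \<or> card E = CARD('p) ^ (CARD('d) - 1))"
  then have tiles: "one_tiles E A" by simp
  have "card A = CARD('p)" if "card E = CARD('p) ^ (CARD('d) - 1)"
  proof -
    \<comment> \<open>The truncated subtraction is harmless because \<open>CARD('d)\<close> is
      positive.\<close>
    have "CARD('p) ^ (CARD('d) - 1) * card A = CARD('p) ^ (CARD('d) - 1) * CARD('p)"
      using one_tiles_card[OF tiles] that
      by (metis power_minus_mult zero_less_card_finite)
    then show ?thesis by simp
  qed
  with * show "is_graph E \<or> is_graph A"
    by (blast intro: one_tiles_card_prime_imp_is_graph one_tiles_sym)
qed

end
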